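(* Let $G$ be a finite, connected, simple undirected graph with vertices $v_0,\dots,v_n$ and edge set $E$. Let $\mathcal{O}$ be a $G$-semiorientation and let $r=\rho(\mathcal{O})$ be the set of $x\in\mathbb{R}^{n+1}$ with $x_j>x_i+1$ whenever $(v_i,v_j)\in\mathcal{O}$ and $|x_i-x_j|<1$ whenever $\{v_i,v_j\}\in E$ is blank in $\mathcal{O}$. For $t=(t_0,\dots,t_n)\in r$, let $P_t$ be the $G$-semiorder on $\{v_0,\dots,v_n\}$ given by $v_i<v_j$ iff $t_i+1<t_j$ (i.e. the interval order of the intervals $[t_i,t_i+1]$, with $[t_i,t_i+1]$ identified with $v_i$). Then the set $\{P_t: t\in r\}$ is exactly the set of $G$-semiorders compatible with $\mathcal{O}$.
   Context: A partial orientation of $G$ is a subset $\mathcal{O}\subseteq V\times V$ such that if $(u,v)\in\mathcal{O}$ then $\{u,v\}\in E$ and $(v,u)\notin\mathcal{O}$; edges with neither orientation in $\mathcal{O}$ are blank. A cycle of $G$ is a potential cycle for $\mathcal{O}$ if its blank edges can be directed to make it a directed cycle. A $G$-semiorientation is a partial orientation whose every potential cycle has strictly more blank than oriented edges. A semiorder is a poset isomorphic to the order on a finite set of unit closed intervals $[a,a+1]$ with $[a,a+1]<[b,b+1]$ iff $a+1<b$; a $G$-semiorder is a semiorder on the vertex set $V$. A $G$-semiorder $P$ and a $G$-semiorientation $\mathcal{O}$ are compatible if for every edge $\{u,v\}\in E$, $u<v$ in $P$ iff $(u,v)\in\mathcal{O}$. *)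

theory Defs
  imports "HOL-Analysis.Analysis"
begin

definition simple_graph :: "'a set \<Rightarrow> 'a set set \<Rightarrow> bool" where
  "simple_graph V E \<longleftrightarrow> finite V \<and> E \<subseteq> {{u, w} | u w. u \<in> V \<and> w \<in> V \<and> u \<noteq> w}"

definition connected_graph :: "'a set \<Rightarrow> 'a set set \<Rightarrow> bool" where
  "connected_graph V E \<longleftrightarrow>
     V \<noteq> {} \<and> (\<forall>u\<in>V. \<forall>w\<in>V. (u, w) \<in> {(a, b). {a, b} \<in> E}\<^sup>*)"

definition partial_orientation :: "'a set \<Rightarrow> 'a set set \<Rightarrow> 'a rel \<Rightarrow> bool" where
  "partial_orientation V E \<O> \<longleftrightarrow>
     \<O> \<subseteq> V \<times> V \<and> (\<forall>u w. (u, w) \<in> \<O> \<longrightarrow> {u, w} \<in> E \<and> (w, u) \<notin> \<O>)"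

text \<open>Since \<open>{u, w} = {w, u}\<close>, the quantifiers below cover both orientations of \<open>e\<close>.\<close>

definition blank_edges :: "'a set set \<Rightarrow> 'a rel \<Rightarrow> 'a set set" where
  "blank_edges E \<O> = {e \<in> E. \<forall>u w. e = {u, w} \<longrightarrow> (u, w) \<notin> \<O>}"

text \<open>A cycle is given by the list of its vertices in cyclic order, without repeating the
  first vertex at the end; the same cycle is represented by all rotations of the list and of
  its reverse.\<close>

definition cycle_arcs :: "'a list \<Rightarrow> 'a rel" where
  "cycle_arcs c = {(c ! i, c ! (Suc i mod length c)) | i. i < length c}"

definition cycle_edges :: "'a list \<Rightarrow> 'a set set" where
  "cycle_edges c = {{u, w} | u w. (u, w) \<in> cycle_arcs c}"

definition graph_cycle :: "'a set \<Rightarrow> 'a set set \<Rightarrow> 'a list \<Rightarrow> bool" where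
  "graph_cycle V E c \<longleftrightarrow>
     length c \<ge> 3 \<and> distinct c \<and> set c \<subseteq> V \<and> cycle_edges c \<subseteq> E"

text \<open>\<open>B\<close> is the set of directions chosen for the blank edges of the cycle \<open>c\<close>.\<close>

definition potential_cycle :: "'a set \<Rightarrow> 'a set set \<Rightarrow> 'a rel \<Rightarrow> 'a list \<Rightarrow> bool" where
  "potential_cycle V E \<O> c \<longleftrightarrow>
     graph_cycle V E c \<and>
     (\<exists>B. (\<forall>u w. (u, w) \<in> B \<longrightarrow> {u, w} \<in> cycle_edges c \<inter> blank_edges E \<O>) \<and>
          partial_orientation V E (\<O> \<union> B) \<and>
          (cycle_arcs c \<subseteq> \<O> \<union> B \<or> (cycle_arcs c)\<inverse> \<subseteq> \<O> \<union> B))"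

definition semiorientation :: "'a set \<Rightarrow> 'a set set \<Rightarrow> 'a rel \<Rightarrow> bool" where
  "semiorientation V E \<O> \<longleftrightarrow>
     partial_orientation V E \<O> \<and>
     (\<forall>c. potential_cycle V E \<O> c \<longrightarrow>
        card (cycle_edges c \<inter> blank_edges E \<O>) > card (cycle_edges c - blank_edges E \<O>))"

definition unit_intervals :: "real set set" where
  "unit_intervals = {{a..a + 1} | a. True}"

definition interval_less :: "real set rel" where
  "interval_less = {({a..a + 1}, {b..b + 1}) | a b. a + 1 < b}"

text \<open>A poset on \<open>V\<close> is represented by its strict order relation: \<open>(u, w) \<in> P\<close> means
  \<open>u < w\<close>. The isomorphism is with a \<^emph>\<open>set\<close> of intervals, so distinct
  elements of \<open>V\<close> correspond to distinct intervals.\<close>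

definition semiorder_on :: "'a set \<Rightarrow> 'a rel \<Rightarrow> bool" where
  "semiorder_on V P \<longleftrightarrow>
     P \<subseteq> V \<times> V \<and> irrefl P \<and> trans P \<and>
     (\<exists>S f. finite S \<and> S \<subseteq> unit_intervals \<and> bij_betw f V S \<and>
        (\<forall>u\<in>V. \<forall>w\<in>V. (u, w) \<in> P \<longleftrightarrow> (f u, f w) \<in> interval_less))"

definition compatible :: "'a set set \<Rightarrow> 'a rel \<Rightarrow> 'a rel \<Rightarrow> bool" where
  "compatible E P \<O> \<longleftrightarrow> (\<forall>u w. {u, w} \<in> E \<longrightarrow> ((u, w) \<in> P \<longleftrightarrow> (u, w) \<in> \<O>))"

text \<open>The vertices are enumerated by \<open>v\<close>, indexed by a finite type \<open>'n\<close> with \<open>n + 1\<close>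
  elements, so that \<open>real ^ 'n\<close> is the (n+1)-dimensional Euclidean space.\<close>

definition region :: "('n::finite \<Rightarrow> 'a) \<Rightarrow> 'a set set \<Rightarrow> 'a rel \<Rightarrow> (real ^ 'n) set" where
  "region v E \<O> =
     {x. (\<forall>i j. (v i, v j) \<in> \<O> \<longrightarrow> x $ j > x $ i + 1) \<and>
         (\<forall>i j. {v i, v j} \<in> blank_edges E \<O> \<longrightarrow> \<bar>x $ i - x $ j\<bar> < 1)}"

definition point_order :: "('n::finite \<Rightarrow> 'a) \<Rightarrow> real ^ 'n \<Rightarrow> 'a rel" where
  "point_order v t = {(v i, v j) | i j. t $ i + 1 < t $ j}"

end

theory Submission
  imports Defs
begin

text \<open>Both inclusions rest on one perturbation: the differences \<open>> 1\<close> and \<open>\<le> 1\<close> of finitely many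
  reals survive shrinking by a factor slightly below 1, which makes the weak inequalities strict,
  followed by a still smaller shift, which makes the reals distinct. Distinctness turns \<open>P\<^sub>t\<close> into a
  semiorder represented by distinct intervals; strictness moves an interval representation of a
  compatible semiorder into the open region.\<close>

text \<open>Here \<open>d\<close> stands for a difference of two of the given reals and
  \<open>k\<close> for the difference of their shifts. The shift has order \<open>e\<^sup>2\<close>,
  so it cannot undo the first-order decrease that the factor \<open>1 - e\<close> causes when
  \<open>d = 1\<close>. The "eventually" form lets the conditions for finitely many pairs share a
  single \<open>e\<close>.\<close>

lemma eventually_perturbed_difference:
  fixes d k :: real
  shows "\<forall>\<^sub>F e in at_right 0. (1 < (1 - e) * d + e\<^sup>2 * k \<longleftrightarrow> 1 < d) \<and>
    (1 - e) * d + e\<^sup>2 * k \<noteq> 1 \<and> (k \<noteq> 0 \<longrightarrow> (1 - e) * d + e\<^sup>2 * k \<noteq> 0)"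
proof -
  let ?D = "\<lambda>e. (1 - e) * d + e\<^sup>2 * k"
  have "(?D \<longlongrightarrow> (1 - 0) * d + 0\<^sup>2 * k) (at_right 0)"
    by (intro tendsto_intros)
  then have lim: "(?D \<longlongrightarrow> d) (at_right 0)"
    by simp
  have pos: "\<forall>\<^sub>F e in at_right (0::real). 0 < e"
    by (rule eventually_at_right_less)
  have one: "\<forall>\<^sub>F e in at_right 0. (1 < ?D e \<longleftrightarrow> 1 < d) \<and> ?D e \<noteq> 1"
  proof (cases d "1::real" rule: linorder_cases)
    case less
    with order_tendstoD(2)[OF lim less] show ?thesis
      by (auto elim: eventually_mono)
  next
    case greater
    with order_tendstoD(1)[OF lim greater] show ?thesis
      by (auto elim: eventually_mono)
  next
    \<comment> \<open>The limit is 1 and decides nothing here. The difference is now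
      \<open>1 - e + e\<^sup>2 * k\<close>, which is below 1 as soon as
      \<open>e * k < 1\<close>.\<close>
    case equal
    have "((\<lambda>e. e * k) \<longlongrightarrow> 0 * k) (at_right 0)"
      by (intro tendsto_intros)
    then have "\<forall>\<^sub>F e in at_right 0. e * k < 1"
      by (auto dest: order_tendstoD(2)[where a = 1])
    with pos show ?thesis
    proof eventually_elim
      case (elim e)
      then have "e * (e * k) < e * 1"
        by (intro mult_strict_left_mono)
      then have "e\<^sup>2 * k < e"
        by (simp add: power2_eq_square mult.assoc)
      with equal show ?case
        by simp
    qed
  qed
  have "\<forall>\<^sub>F e in at_right 0. k \<noteq> 0 \<longrightarrow> ?D e \<noteq> 0"
  \<comment> \<open>For \<open>d = 0\<close> only \<open>e\<^sup>2 * k\<close> remains; otherwise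
    the limit \<open>d\<close> is itself nonzero.\<close>
  proof (cases "d = 0")
    case True
    with pos show ?thesis
      by (auto elim: eventually_mono)
  next
    case False
    with tendsto_imp_eventually_ne[OF lim False] show ?thesis
      by (auto elim: eventually_mono)
  qed
  with one show ?thesis
    by eventually_elim blast
qed

lemma generic_unit_interval_representation:
  fixes t :: "'n::finite \<Rightarrow> real"
  shows "\<exists>s :: 'n \<Rightarrow> real. inj s \<and> (\<forall>i j. s i + 1 < s j \<longleftrightarrow> t i + 1 < t j) \<and> (\<forall>i j. s j \<noteq> s i + 1)"
proof -
  \<comment> \<open>Distinct labels as shifts: they separate indices at which \<open>t\<close> takes
    the same value.\<close>
  obtain g :: "'n \<Rightarrow> nat" where g: "inj g"
    using finite_imp_inj_to_nat_seg[of "UNIV :: 'n set"] by auto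
  define s where "s e i = (1 - e) * t i + e\<^sup>2 * real (g i)" for e i
  have diff: "s e j - s e i = (1 - e) * (t j - t i) + e\<^sup>2 * (real (g j) - real (g i))" for e i j
    by (simp add: s_def algebra_simps)
  have "\<forall>\<^sub>F e in at_right 0. \<forall>i j. (1 < s e j - s e i \<longleftrightarrow> 1 < t j - t i) \<and>
      s e j - s e i \<noteq> 1 \<and> (real (g j) - real (g i) \<noteq> 0 \<longrightarrow> s e j - s e i \<noteq> 0)"
    unfolding diff by (intro eventually_all_finite eventually_perturbed_difference)
  then obtain e where e: "\<And>i j. (1 < s e j - s e i \<longleftrightarrow> 1 < t j - t i) \<and>
      s e j - s e i \<noteq> 1 \<and> (real (g j) - real (g i) \<noteq> 0 \<longrightarrow> s e j - s e i \<noteq> 0)"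
    using eventually_happens'[OF trivial_limit_at_right_real] by blast
  show ?thesis
  proof (intro exI conjI allI)
    show "inj (s e)"
    proof (rule injI)
      fix i j assume "s e i = s e j"
      with e[of j i] have "g j = g i"
        by auto
      with g show "i = j"
        by (simp add: inj_eq)
    qed
    show "s e i + 1 < s e j \<longleftrightarrow> t i + 1 < t j" "s e j \<noteq> s e i + 1" for i j
      using e[where i = i and j = j] by linarith+
  qed
qed

lemma unit_interval_eq_iff: "{a..a + 1} = {b..b + 1} \<longleftrightarrow> a = b" for a b :: real
  by (simp add: Icc_eq_Icc)

lemma interval_less_iff: "({a..a + 1}, {b..b + 1}) \<in> interval_less \<longleftrightarrow> a + 1 < b"
  by (auto simp: interval_less_def Icc_eq_Icc)

lemma point_order_iff:
  assumes "inj v"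
  shows "(v i, v j) \<in> point_order v t \<longleftrightarrow> t $ i + 1 < t $ j"
  using assms by (auto simp: point_order_def inj_eq)

text \<open>The coordinates of \<open>t\<close> may repeat, whereas \<open>semiorder_on\<close> asks
  for a bijection onto a set of intervals. The intervals are therefore built from an injective
  \<open>s\<close> that induces the same order.\<close>

lemma semiorder_on_point_order:
  fixes v :: "'n::finite \<Rightarrow> 'a"
  assumes v: "bij_betw v UNIV V"
  shows "semiorder_on V (point_order v t)"
proof -
  have inj: "inj v" and V: "V = range v"
    using v by (auto simp: bij_betw_def)
  obtain s :: "'n \<Rightarrow> real" where s: "inj s" "\<And>i j. s i + 1 < s j \<longleftrightarrow> t $ i + 1 < t $ j"
    using generic_unit_interval_representation[of "\<lambda>i. t $ i"] by blast
  define f where "f u = {s (inv v u)..s (inv v u) + 1}" for u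
  have f: "f (v i) = {s i..s i + 1}" for i
    using inj by (simp add: f_def)
  have "inj_on f V"
    using s(1) by (auto simp: inj_on_def V f unit_interval_eq_iff)
  then have "bij_betw f V (f ` V)"
    by (rule inj_on_imp_bij_betw)
  moreover have "finite (f ` V)" "f ` V \<subseteq> unit_intervals"
    by (auto simp: V f unit_intervals_def)
  moreover have "(u, w) \<in> point_order v t \<longleftrightarrow> (f u, f w) \<in> interval_less"
    if "u \<in> V" "w \<in> V" for u w
    using that by (auto simp: V f interval_less_iff s(2) point_order_iff[OF inj])
  moreover have "point_order v t \<subseteq> V \<times> V"
    by (auto simp: point_order_def V)
  moreover have "irrefl (point_order v t)"
    using inj by (auto simp: irrefl_def point_order_def inj_eq)
  moreover have "trans (point_order v t)"
    using inj by (force simp: trans_def point_order_def inj_eq)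
  ultimately show ?thesis
    unfolding semiorder_on_def by blast
qed

lemma compatible_point_order:
  fixes v :: "'n::finite \<Rightarrow> 'a"
  assumes G: "simple_graph V E" and v: "bij_betw v UNIV V" and t: "t \<in> region v E \<O>"
  shows "compatible E (point_order v t) \<O>"
  unfolding compatible_def
proof (intro allI impI)
  fix u w assume edge: "{u, w} \<in> E"
  have inj: "inj v" and V: "V = range v"
    using v by (auto simp: bij_betw_def)
  have "u \<in> V" "w \<in> V"
    using G edge by (auto simp: simple_graph_def doubleton_eq_iff subset_iff)
  then obtain i j where ij: "u = v i" "w = v j"
    unfolding V by blast
  \<comment> \<open>By elimination: \<open>t $ i + 1 < t $ j\<close> contradicts the region's
    inequality both for a blank edge and for the reversed orientation.\<close>
  have "{u, w} \<in> blank_edges E \<O> \<or> (u, w) \<in> \<O> \<or> (w, u) \<in> \<O>"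
    using edge by (auto simp: blank_edges_def doubleton_eq_iff)
  moreover have "t $ i + 1 < t $ j" if "(u, w) \<in> \<O>"
    using t that by (auto simp: region_def ij)
  moreover have "t $ j + 1 < t $ i" if "(w, u) \<in> \<O>"
    using t that by (auto simp: region_def ij)
  moreover have "\<bar>t $ i - t $ j\<bar> < 1" if "{u, w} \<in> blank_edges E \<O>"
    using t that by (auto simp: region_def ij)
  ultimately show "(u, w) \<in> point_order v t \<longleftrightarrow> (u, w) \<in> \<O>"
    unfolding ij point_order_iff[OF inj] by fastforce
qed

text \<open>Left endpoints of an arbitrary representation can miss the open region: intervals that
  just touch are incomparable, so a blank edge bounds their distance only by \<le> 1. The perturbed
  endpoints avoid distance exactly 1.\<close>

lemma compatible_semiorder_in_region:
  fixes v :: "'n::finite \<Rightarrow> 'a"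
  assumes v: "bij_betw v UNIV V" and O: "partial_orientation V E \<O>"
    and P: "semiorder_on V P" and comp: "compatible E P \<O>"
  shows "\<exists>t \<in> region v E \<O>. P = point_order v t"
proof -
  have inj: "inj v" and V: "V = range v"
    using v by (auto simp: bij_betw_def)
  obtain S f where S: "S \<subseteq> unit_intervals" "bij_betw f V S"
    and f: "\<And>u w. u \<in> V \<Longrightarrow> w \<in> V \<Longrightarrow> (u, w) \<in> P \<longleftrightarrow> (f u, f w) \<in> interval_less"
    using P unfolding semiorder_on_def by blast
  have "\<exists>a. f (v i) = {a..a + 1}" for i
    using S V unfolding bij_betw_def unit_intervals_def by blast
  then obtain a where a: "\<And>i. f (v i) = {a i..a i + 1}"
    by metis
  obtain s :: "'n \<Rightarrow> real" where
    s: "\<And>i j. s i + 1 < s j \<longleftrightarrow> a i + 1 < a j" "\<And>i j. s j \<noteq> s i + 1"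
    using generic_unit_interval_representation[of a] by blast
  have P_iff: "(v i, v j) \<in> P \<longleftrightarrow> s i + 1 < s j" for i j
    by (simp add: f V a interval_less_iff s(1))
  define t :: "real ^ 'n" where "t = (\<chi> i. s i)"
  have "P \<subseteq> V \<times> V"
    using P by (simp add: semiorder_on_def)
  then have "P = point_order v t"
    using P_iff by (force simp: point_order_def t_def V)
  \<comment> \<open>Compatibility speaks only of edges; \<open>partial_orientation\<close> makes
    every oriented pair one.\<close>
  moreover have "t $ i + 1 < t $ j" if "(v i, v j) \<in> \<O>" for i j
    using that O comp
    by (auto simp: t_def partial_orientation_def compatible_def simp flip: P_iff)
  moreover have "\<bar>t $ i - t $ j\<bar> < 1" if "{v i, v j} \<in> blank_edges E \<O>" for i j
  proof -
    have "{v i, v j} \<in> E" "{v j, v i} \<in> E" "(v i, v j) \<notin> \<O>" "(v j, v i) \<notin> \<O>"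
      using that by (auto simp: blank_edges_def insert_commute)
    then have "\<not> s i + 1 < s j" "\<not> s j + 1 < s i"
      using comp by (auto simp: compatible_def simp flip: P_iff)
    with s(2)[of j i] s(2)[of i j] show ?thesis
      by (simp add: t_def abs_less_iff)
  qed
  ultimately show ?thesis
    by (auto simp: region_def)
qed

theorem theorem3p6:
  fixes V :: "'a set" and E :: "'a set set" and v :: "'n::finite \<Rightarrow> 'a" and \<O> :: "'a rel"
  assumes "simple_graph V E"
    and "connected_graph V E"
    and "bij_betw v UNIV V"
    and "semiorientation V E \<O>"
  shows "{point_order v t | t. t \<in> region v E \<O>} =
         {P. semiorder_on V P \<and> compatible E P \<O>}"
proof -
  have "partial_orientation V E \<O>"
    using assms(4) by (simp add: semiorientation_def)
  with assms(1,3) show ?thesis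
    using semiorder_on_point_order compatible_point_order compatible_semiorder_in_region
    by blast
qed

end
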